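(* Let $\mathcal K:=\{g\in\breve{\mathcal C}:\ \sigma(g)\ge\frac15,\ \int g\ge\frac15\}$. Then: (a) $T(\mathcal K)\subseteq\mathcal K\cap\breve{\mathcal D}^\sharp$; (b) for each $f\in\mathcal E$ there exists $n\in\mathbb N$ with $T^nf\in\mathcal K$; (c) $d_1(f,g)\le d_\infty(f,g)\le5\sqrt{d_1(f,g)}$ for all $f,g\in\mathcal K$; (d) the metric spaces $(\mathcal K,d_\infty)$ and $(\mathcal K,d_1)$ are complete; (e) the restriction $T|_{\mathcal K}\colon\mathcal K\to\mathcal K$ is continuous when domain and codomain are each equipped, independently, with $d_\infty$ or $d_1$; (f) every sequence in $(\mathcal K,d_\infty)$ or in $(\mathcal K,d_1)$ has a convergent subsequence.
   Context: "Decreasing" means non-increasing; $\int f:=\int_0^1 f(x)\,dx$. $\mathcal E$: measurable decreasing $f\colon[0,1]\to[0,\infty)$ with $f(0)=1$ and $\int f>0$. $\mathcal C$: continuous $f\in\mathcal E$ with $f(1)=0$; $\breve{\mathcal C}$: convex $f\in\mathcal C$. $\mathcal D$: strictly decreasing $f\in\mathcal C$. $\mathcal D'$: $f\in\mathcal D$ continuously differentiable on $(0,1]$. $\mathcal D^\sharp$: $f\in\mathcal D'$ with $f'(1)=0$ and $\lim_{x\to0}f'(x)$ existing in $(-\infty,0]$; $\breve{\mathcal D}^\sharp:=\mathcal D^\sharp\cap\breve{\mathcal C}$. For $g\in\breve{\mathcal C}$, the stride is $\sigma(g):=\sup\{\alpha\ge0:\ \alpha-x\le\alpha g(x)\ \forall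 x\in[0,1]\}$. For $g\in\mathcal E$, $g^*(y):=\sup\{x\in[0,1]:g(x)\ge y\}$. $T$ on $\mathcal E$: $(Tf)(x)=\frac{\int_x^1f^*}{\int f}$, $T^n=T\circ T^{n-1}$. Metrics on $\mathcal E$: $d_\infty(f,g):=\sup_{x\in[0,1]}|f(x)-g(x)|$ and $d_1(f,g):=\int_0^1|f-g|$. $\mathbb N=\{1,2,\dots\}$. *)

theory Defs
  imports "HOL-Analysis.Analysis"
begin

text \<open>Functions on [0,1] are represented as real \<Rightarrow> real; only values on [0,1] matter.
  Integrals are over [0,1] (bounded monotone functions there are integrable).\<close>

definition intg :: "(real \<Rightarrow> real) \<Rightarrow> real" where
  "intg f = integral {0..1} f"

definition decreasing01 :: "(real \<Rightarrow> real) \<Rightarrow> bool" where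
  "decreasing01 f \<longleftrightarrow> (\<forall>x\<in>{0..1}. \<forall>y\<in>{0..1}. x \<le> y \<longrightarrow> f y \<le> f x)"

definition strictly_decreasing01 :: "(real \<Rightarrow> real) \<Rightarrow> bool" where
  "strictly_decreasing01 f \<longleftrightarrow> (\<forall>x\<in>{0..1}. \<forall>y\<in>{0..1}. x < y \<longrightarrow> f y < f x)"

text \<open>class E (measurability is automatic for monotone functions)\<close>
definition classE :: "(real \<Rightarrow> real) set" where
  "classE = {f. decreasing01 f \<and> (\<forall>x\<in>{0..1}. 0 \<le> f x) \<and> f 0 = 1 \<and> intg f > 0}"

definition classC :: "(real \<Rightarrow> real) set" where
  "classC = {f. f \<in> classE \<and> continuous_on {0..1} f \<and> f 1 = 0}"

definition classC_convex :: "(real \<Rightarrow> real) set" where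
  "classC_convex = {f. f \<in> classC \<and> convex_on {0..1} f}"

definition classD :: "(real \<Rightarrow> real) set" where
  "classD = {f. f \<in> classC \<and> strictly_decreasing01 f}"

definition C1_deriv01 :: "(real \<Rightarrow> real) \<Rightarrow> (real \<Rightarrow> real) \<Rightarrow> bool" where
  "C1_deriv01 f f' \<longleftrightarrow>
     (\<forall>x\<in>{0<..1}. (f has_real_derivative f' x) (at x within {0..1})) \<and> continuous_on {0<..1} f'"

definition classD' :: "(real \<Rightarrow> real) set" where
  "classD' = {f. f \<in> classD \<and> (\<exists>f'. C1_deriv01 f f')}"

definition classD_sharp :: "(real \<Rightarrow> real) set" where
  "classD_sharp = {f. f \<in> classD \<and> (\<exists>f'. C1_deriv01 f f' \<and> f' 1 = 0 \<and>
      (\<exists>L. L \<le> 0 \<and> (f' \<longlongrightarrow> L) (at_right 0)))}"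

definition classD_sharp_convex :: "(real \<Rightarrow> real) set" where
  "classD_sharp_convex = classD_sharp \<inter> classC_convex"

definition stride :: "(real \<Rightarrow> real) \<Rightarrow> real" where
  "stride g = Sup {\<alpha>. \<alpha> \<ge> 0 \<and> (\<forall>x\<in>{0..1}. \<alpha> - x \<le> \<alpha> * g x)}"

definition gstar :: "(real \<Rightarrow> real) \<Rightarrow> real \<Rightarrow> real" where
  "gstar g y = Sup {x\<in>{0..1}. g x \<ge> y}"

definition opT :: "(real \<Rightarrow> real) \<Rightarrow> (real \<Rightarrow> real)" where
  "opT f = (\<lambda>x. integral {x..1} (gstar f) / intg f)"

definition d_inf :: "(real \<Rightarrow> real) \<Rightarrow> (real \<Rightarrow> real) \<Rightarrow> real" where
  "d_inf f g = Sup ((\<lambda>x. \<bar>f x - g x\<bar>) ` {0..1})"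

definition d_1 :: "(real \<Rightarrow> real) \<Rightarrow> (real \<Rightarrow> real) \<Rightarrow> real" where
  "d_1 f g = integral {0..1} (\<lambda>x. \<bar>f x - g x\<bar>)"

definition classK :: "(real \<Rightarrow> real) set" where
  "classK = {g. g \<in> classC_convex \<and> stride g \<ge> 1/5 \<and> intg g \<ge> 1/5}"

definition complete_wrt :: "(real \<Rightarrow> real) set \<Rightarrow> ((real \<Rightarrow> real) \<Rightarrow> (real \<Rightarrow> real) \<Rightarrow> real) \<Rightarrow> bool" where
  "complete_wrt S d \<longleftrightarrow> (\<forall>u. (\<forall>n. u n \<in> S) \<and>
       (\<forall>e>0. \<exists>N. \<forall>m\<ge>N. \<forall>n\<ge>N. d (u m) (u n) < e)
     \<longrightarrow> (\<exists>g\<in>S. (\<lambda>n. d (u n) g) \<longlonglongrightarrow> 0))"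

definition continuous_wrt :: "(real \<Rightarrow> real) set \<Rightarrow> ((real \<Rightarrow> real) \<Rightarrow> (real \<Rightarrow> real) \<Rightarrow> real)
   \<Rightarrow> ((real \<Rightarrow> real) \<Rightarrow> (real \<Rightarrow> real) \<Rightarrow> real) \<Rightarrow> ((real \<Rightarrow> real) \<Rightarrow> (real \<Rightarrow> real)) \<Rightarrow> bool" where
  "continuous_wrt S da db F \<longleftrightarrow> (\<forall>f\<in>S. \<forall>e>0. \<exists>\<delta>>0. \<forall>g\<in>S. da f g < \<delta> \<longrightarrow> db (F f) (F g) < e)"

definition seq_compact_wrt :: "(real \<Rightarrow> real) set \<Rightarrow> ((real \<Rightarrow> real) \<Rightarrow> (real \<Rightarrow> real) \<Rightarrow> real) \<Rightarrow> bool" where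
  "seq_compact_wrt S d \<longleftrightarrow> (\<forall>u. (\<forall>n. u n \<in> S) \<longrightarrow>
      (\<exists>(r::nat\<Rightarrow>nat) g. strict_mono r \<and> g \<in> S \<and> (\<lambda>n. d (u (r n)) g) \<longlonglongrightarrow> 0))"

end

theory Submission
  imports Defs "HOL-Complex_Analysis.Great_Picard"
begin

text \<open>The layer-cake formula \<open>\<integral>\<^sub>x\<^sup>1 f\<^sup>* = \<integral>\<^sub>0\<^sup>1 max 0 (f t - x) dt\<close> shows that \<open>T f\<close> is convex with stride at
  least \<open>\<integral>f\<close>, that \<open>\<integral>T f = \<integral>f\<^sup>2 / (2 \<integral>f)\<close>, and that \<open>T\<close> is Lipschitz on \<open>K\<close> from \<open>d\<^sub>1\<close> to
  \<open>d\<^sub>\<infinity>\<close>. Comparing a convex \<open>g\<close> of stride at least \<open>s \<le> 1/5\<close> with a broken line gives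
  \<open>\<integral>T g \<ge> (51/50) s\<close>; hence \<open>K\<close> is invariant, and the strides of the iterates of any \<open>f\<close> grow
  geometrically until they reach 1/5. Members of \<open>K\<close> have slopes in \<open>[-5, 0]\<close>, which yields the
  comparison of the metrics and, by the Arzela-Ascoli theorem, compactness and completeness.\<close>


section \<open>Decreasing functions on the unit interval\<close>

lemma decreasing01_integrable:
  assumes "decreasing01 f"
  shows "f integrable_on {0..1}"
proof -
  have "mono_on {0..1} (\<lambda>x. - f x)"
    using assms by (auto simp: mono_on_def decreasing01_def)
  then have "(\<lambda>x. - f x) integrable_on {0..1}"
    by (rule integrable_on_mono_on)
  then show ?thesis
    using integrable_neg by fastforce
qed

lemma integral_unit_le_strip:
  fixes D :: "real \<Rightarrow> real"
  assumes "D integrable_on {0..1}" "0 \<le> a" "a \<le> 1"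
    and "\<And>t. t \<in> {0..a} \<Longrightarrow> D t \<le> c" "\<And>t. t \<in> {a<..1} \<Longrightarrow> D t \<le> 0"
  shows "integral {0..1} D \<le> c * a"
proof -
  let ?s = "\<lambda>t. if t \<in> {0..a} then c else 0"
  have sub: "{0..a} \<inter> {0..1} = {0..a}"
    using assms by auto
  have "?s integrable_on {0..1}"
    unfolding integrable_restrict_Int sub by (rule integrable_const_ivl)
  then have "integral {0..1} D \<le> integral {0..1} ?s"
    using assms by (intro integral_le) auto
  also have "\<dots> = c * a"
    unfolding Henstock_Kurzweil_Integration.integral_restrict_Int sub using assms by simp
  finally show ?thesis .
qed

text \<open>The strip is open because \<open>below_gstar\<close> controls a function only strictly
  below the supremum of a superlevel set.\<close>

lemma integral_unit_ge_strip:
  fixes D :: "real \<Rightarrow> real"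
  assumes "D integrable_on {0..1}" "0 \<le> a" "a \<le> b" "b \<le> 1"
    and "\<And>t. t \<in> {a<..<b} \<Longrightarrow> c \<le> D t" "\<And>t. t \<in> {0..1} \<Longrightarrow> 0 \<le> D t"
  shows "c * (b - a) \<le> integral {0..1} D"
proof -
  let ?s = "\<lambda>t. if t \<in> {a<..<b} then c else 0"
  have sub: "{a<..<b} \<inter> {0..1} = {a<..<b}"
    using assms by auto
  have "?s integrable_on {0..1}"
    unfolding integrable_restrict_Int sub integrable_on_Icc_iff_Ioo[symmetric] by (rule integrable_const_ivl)
  then have "integral {0..1} ?s \<le> integral {0..1} D"
    using assms by (intro integral_le) auto
  moreover have "integral {0..1} ?s = c * (b - a)"
    unfolding Henstock_Kurzweil_Integration.integral_restrict_Int sub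
      integral_open_interval_real[symmetric] using assms by simp
  ultimately show ?thesis by simp
qed

text \<open>On \<open>n + 1\<close> equal pieces the bounds telescope to a constant divided by
  \<open>n + 1\<close>. This replaces an argument by differentiation and works even where
  \<open>G\<close> jumps.\<close>

lemma eq_if_increments_le_monotone_product:
  fixes D G :: "real \<Rightarrow> real"
  assumes "a \<le> b"
    and incr: "\<And>x y. a \<le> x \<Longrightarrow> x \<le> y \<Longrightarrow> y \<le> b \<Longrightarrow> \<bar>D x - D y\<bar> \<le> (y - x) * (G x - G y)"
  shows "D a = D b"
proof -
  have bound: "\<bar>D a - D b\<bar> \<le> (b - a) * (G a - G b) / real (Suc n)" for n
  proof -
    define h where "h = (b - a) / real (Suc n)"
    define p where "p i = a + real i * h" for i
    have h: "0 \<le> h" "real (Suc n) * h = b - a"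
      using \<open>a \<le> b\<close> by (auto simp: h_def)
    have range: "a \<le> p i" "p i \<le> b" if "i \<le> Suc n" for i
    proof -
      have "real i * h \<le> real (Suc n) * h"
        using that h by (intro mult_right_mono) auto
      then show "a \<le> p i" "p i \<le> b"
        using h by (auto simp: p_def)
    qed
    have step: "p (Suc i) - p i = h" for i
      by (simp add: p_def algebra_simps)
    have "\<bar>D (p 0) - D (p k)\<bar> \<le> h * (G (p 0) - G (p k))" if "k \<le> Suc n" for k
      using that
    proof (induction k)
      case (Suc k)
      then have "\<bar>D (p k) - D (p (Suc k))\<bar> \<le> h * (G (p k) - G (p (Suc k)))"
        using incr[of "p k" "p (Suc k)"] range[of k] range[of "Suc k"] step[of k] h by auto
      then show ?case
        using Suc by (simp add: right_diff_distrib)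
    qed simp
    from this[of "Suc n"] show ?thesis
      using h by (auto simp: p_def h_def)
  qed
  have "(\<lambda>n. (b - a) * (G a - G b) / real (Suc n)) \<longlonglongrightarrow> 0"
    by (intro LIMSEQ_Suc lim_const_over_n)
  then have "\<bar>D a - D b\<bar> \<le> 0"
    using bound by (intro LIMSEQ_le_const) auto
  then show ?thesis by simp
qed

section \<open>The layer-cake formula for the operator\<close>

text \<open>The area below the graph of \<open>f\<close> and above the horizontal line at height
  \<open>x\<close>. By \<open>integral_gstar\<close> it is the numerator of \<open>opT f x\<close>,
  expressed without the generalized inverse.\<close>

definition excess :: "(real \<Rightarrow> real) \<Rightarrow> real \<Rightarrow> real" where
  "excess f x = integral {0..1} (\<lambda>t. max 0 (f t - x))"

lemma classE_D:
  assumes "f \<in> classE"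
  shows "decreasing01 f" "f 0 = 1" "intg f > 0" "f integrable_on {0..1}"
    and "\<And>x. x \<in> {0..1} \<Longrightarrow> 0 \<le> f x" "\<And>x. x \<in> {0..1} \<Longrightarrow> f x \<le> 1"
proof -
  show dec: "decreasing01 f" and "f 0 = 1" "intg f > 0" "\<And>x. x \<in> {0..1} \<Longrightarrow> 0 \<le> f x"
    using assms by (auto simp: classE_def)
  then show "\<And>x. x \<in> {0..1} \<Longrightarrow> f x \<le> 1"
    unfolding decreasing01_def by (metis atLeastAtMost_iff order_refl zero_le_one)
  show "f integrable_on {0..1}"
    using dec by (rule decreasing01_integrable)
qed

lemma excess_integrable:
  assumes "decreasing01 f"
  shows "(\<lambda>t. max 0 (f t - x)) integrable_on {0..1}"
  using assms by (intro decreasing01_integrable) (fastforce simp: decreasing01_def)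

text \<open>For \<open>y \<le> 1\<close> the superlevel set contains 0, as \<open>f 0 = 1\<close>;
  for larger \<open>y\<close> it is empty and its \<open>Sup\<close> carries no information.\<close>

lemma gstar_bounds:
  assumes "f \<in> classE" "y \<le> 1"
  shows "0 \<le> gstar f y" "gstar f y \<le> 1"
proof -
  have "0 \<in> {x \<in> {0..1}. f x \<ge> y}"
    using assms by (auto simp: classE_def)
  then show "0 \<le> gstar f y" "gstar f y \<le> 1"
    unfolding gstar_def by (auto intro!: cSup_upper cSup_least bdd_aboveI[of _ 1])
qed

lemma gstar_upper:
  assumes "t \<in> {0..1}" "f t \<ge> y"
  shows "t \<le> gstar f y"
  unfolding gstar_def using assms by (intro cSup_upper) (auto intro!: bdd_aboveI[of _ 1])

text \<open>The supremum need not be attained when \<open>f\<close> jumps, but the superlevel set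
  has a point beyond every \<open>t\<close> below it, and \<open>f\<close> is decreasing.\<close>

lemma below_gstar:
  assumes "f \<in> classE" "y \<le> 1" "0 \<le> t" "t < gstar f y"
  shows "y \<le> f t"
proof -
  have "0 \<in> {x \<in> {0..1}. f x \<ge> y}"
    using assms by (auto simp: classE_def)
  then obtain u where "u \<in> {0..1}" "y \<le> f u" "t < u"
    using less_cSupE[OF assms(4)[unfolded gstar_def]] by blast
  moreover have "f u \<le> f t"
    using classE_D(1)[OF assms(1)] \<open>u \<in> {0..1}\<close> \<open>t < u\<close> assms(3)
    by (auto simp: decreasing01_def)
  ultimately show ?thesis by simp
qed

lemma gstar_antimono:
  assumes "f \<in> classE" "x \<le> y" "y \<le> 1"
  shows "gstar f y \<le> gstar f x"
  unfolding gstar_def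
proof (rule cSup_subset_mono)
  show "{x \<in> {0..1}. y \<le> f x} \<noteq> {}"
    using assms by (auto simp: classE_def intro!: exI[of _ 0])
qed (use assms in \<open>auto intro!: bdd_aboveI[of _ 1]\<close>)

text \<open>The slab of the region under the graph between heights \<open>x\<close> and
  \<open>y\<close> contains a rectangle of width \<open>gstar f y\<close> and fits into one of width
  \<open>gstar f x\<close>.\<close>

lemma excess_diff:
  assumes "f \<in> classE" "x \<le> y" "y \<le> 1"
  shows "(y - x) * gstar f y \<le> excess f x - excess f y"
    and "excess f x - excess f y \<le> (y - x) * gstar f x"
proof -
  define D where "D t = max 0 (f t - x) - max 0 (f t - y)" for t
  have int: "D integrable_on {0..1}"
    unfolding D_def
    by (intro integrable_diff excess_integrable classE_D(1) assms)
  have eq: "excess f x - excess f y = integral {0..1} D"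
    unfolding D_def excess_def
    by (intro integral_diff[symmetric] excess_integrable classE_D(1) assms)
  have "(y - x) * (gstar f y - 0) \<le> integral {0..1} D"
  proof (rule integral_unit_ge_strip[OF int])
    fix t assume t: "t \<in> {0<..<gstar f y}"
    show "y - x \<le> D t"
      using below_gstar[OF assms(1,3), of t] t assms(2) by (auto simp: D_def)
  qed (use gstar_bounds[OF assms(1,3)] assms(2) in \<open>auto simp: D_def\<close>)
  then show "(y - x) * gstar f y \<le> excess f x - excess f y"
    by (simp add: eq)
  show "excess f x - excess f y \<le> (y - x) * gstar f x"
    unfolding eq
  proof (rule integral_unit_le_strip[OF int])
    fix t assume t: "t \<in> {gstar f x<..1}"
    then have "f t < x"
      using gstar_upper[of t x f] gstar_bounds[of f x] assms by force
    then show "D t \<le> 0"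
      using assms(2) by (auto simp: D_def)
  qed (use gstar_bounds[of f x] assms in \<open>auto simp: D_def\<close>)
qed

lemma gstar_integrable:
  assumes "f \<in> classE" "0 \<le> a" "b \<le> 1"
  shows "gstar f integrable_on {a..b}"
proof -
  have "gstar f integrable_on {0..1}"
    using gstar_antimono[OF assms(1)]
    by (intro decreasing01_integrable) (auto simp: decreasing01_def)
  then show ?thesis
    by (rule integrable_on_subinterval) (use assms in auto)
qed

lemma excess_1:
  assumes "f \<in> classE"
  shows "excess f 1 = 0"
proof -
  have "excess f 1 = integral {0..1} (\<lambda>t::real. 0)"
    unfolding excess_def using classE_D(6)[OF assms]
    by (intro Henstock_Kurzweil_Integration.integral_cong) auto
  then show ?thesis by simp
qed

lemma excess_0:
  assumes "f \<in> classE"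
  shows "excess f 0 = intg f"
  unfolding excess_def intg_def using classE_D(5)[OF assms]
  by (intro Henstock_Kurzweil_Integration.integral_cong) auto

text \<open>Both sides have increments over \<open>[u,v]\<close> between \<open>(v - u) f\<^sup>*(v)\<close> and \<open>(v - u) f\<^sup>*(u)\<close>.\<close>

lemma integral_gstar:
  assumes "f \<in> classE" "x \<in> {0..1}"
  shows "integral {x..1} (gstar f) = excess f x"
proof -
  define D where "D u = integral {u..1} (gstar f) - excess f u" for u
  have "D x = D 1"
  proof (rule eq_if_increments_le_monotone_product[where D = D and G = "gstar f"])
    fix u v assume uv: "x \<le> u" "u \<le> v" "v \<le> 1"
    then have int: "gstar f integrable_on {u..1}" "gstar f integrable_on {u..v}"
      using assms by (auto intro!: gstar_integrable)
    have "integral {u..v} (gstar f) + integral {v..1} (gstar f) = integral {u..1} (gstar f)"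
      using uv int by (intro Henstock_Kurzweil_Integration.integral_combine) auto
    moreover have "integral {u..v} (gstar f) \<le> integral {u..v} (\<lambda>_. gstar f u)"
      using uv assms int by (intro integral_le gstar_antimono) auto
    moreover have "integral {u..v} (\<lambda>_. gstar f v) \<le> integral {u..v} (gstar f)"
      using uv assms int by (intro integral_le gstar_antimono) auto
    ultimately show "\<bar>D u - D v\<bar> \<le> (v - u) * (gstar f u - gstar f v)"
      using excess_diff[OF assms(1) uv(2,3)] uv(2)
      by (auto simp: D_def right_diff_distrib)
  qed (use assms in auto)
  then show ?thesis
    using excess_1[OF assms(1)] by (simp add: D_def)
qed

lemma opT_eq:
  assumes "f \<in> classE" "x \<in> {0..1}"
  shows "opT f x = excess f x / intg f"
  using integral_gstar[OF assms] by (simp add: opT_def)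

text \<open>Dropping the \<open>max\<close> in \<open>excess\<close> gives the pointwise bound,
  which says that the stride of \<open>opT f\<close> is at least \<open>intg f\<close>. Convexity
  comes from that of \<open>max 0 (c - x)\<close> in \<open>x\<close>, continuity from
  \<open>0 \<le> gstar f \<le> 1\<close>.\<close>

lemma opT_class:
  assumes f: "f \<in> classE"
  shows "opT f \<in> classC_convex" "\<And>x. x \<in> {0..1} \<Longrightarrow> intg f - x \<le> intg f * opT f x"
proof -
  note E = classE_D[OF f]
  let ?I = "intg f"
  have val: "opT f x = excess f x / ?I" if "x \<in> {0..1}" for x
    using opT_eq[OF f that] .
  show ge: "?I - x \<le> ?I * opT f x" if x: "x \<in> {0..1}" for x
  proof -
    have "integral {0..1} (\<lambda>t. f t - x) \<le> excess f x"
      unfolding excess_def using E by (intro integral_le excess_integrable integrable_diff) auto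
    moreover have "integral {0..1} (\<lambda>t. f t - x) = ?I - x"
      using E by (subst integral_diff) (auto simp: intg_def)
    ultimately show ?thesis
      using val[OF x] E(3) by simp
  qed
  have diff: "0 \<le> excess f x - excess f y" "excess f x - excess f y \<le> y - x"
    if "x \<le> y" "y \<le> 1" for x y
  proof -
    have "0 \<le> (y - x) * gstar f y" "(y - x) * gstar f x \<le> (y - x) * 1"
      using that gstar_bounds[OF f, of x] gstar_bounds[OF f, of y]
      by (intro mult_nonneg_nonneg mult_left_mono; simp)+
    then show "0 \<le> excess f x - excess f y" "excess f x - excess f y \<le> y - x"
      using excess_diff[OF f that] by auto
  qed
  have dec: "decreasing01 (opT f)"
    unfolding decreasing01_def
  proof (intro ballI impI)
    fix x y :: real assume "x \<in> {0..1}" "y \<in> {0..1}" "x \<le> y"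
    then show "opT f y \<le> opT f x"
      using val diff[of x y] E(3) by (auto intro!: divide_right_mono)
  qed
  have at0: "opT f 0 = 1" and at1: "opT f 1 = 0"
    using val[of 0] val[of 1] excess_0[OF f] excess_1[OF f] E(3) by auto
  have nonneg: "0 \<le> opT f x" if "x \<in> {0..1}" for x
    using dec at1 that by (force simp: decreasing01_def)
  have "?I \<le> 1"
    using ge[of 1] at1 by simp
  \<comment> \<open>For positivity of the integral: the line \<open>1 - x / ?I\<close> lies below
    \<open>opT f\<close> and is at least 1/2 up to \<open>?I/2\<close>.\<close>
  have "1/2 * (?I/2 - 0) \<le> integral {0..1} (opT f)"
  proof (rule integral_unit_ge_strip)
    fix t assume t: "t \<in> {0<..<?I/2}"
    then have "?I - ?I / 2 \<le> ?I * opT f t"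
      using ge[of t] \<open>?I \<le> 1\<close> unfolding greaterThanLessThan_iff atLeastAtMost_iff by linarith
    then show "1/2 \<le> opT f t"
      using E(3) by (simp add: field_simps)
  qed (use \<open>?I \<le> 1\<close> E(3) nonneg decreasing01_integrable[OF dec] in auto)
  then have pos: "intg (opT f) > 0"
    using E(3) by (simp add: intg_def)
  have "1-lipschitz_on {0..1} (excess f)"
  proof (rule lipschitz_onI)
    fix x y :: real assume "x \<in> {0..1}" "y \<in> {0..1}"
    then show "dist (excess f x) (excess f y) \<le> 1 * dist x y"
      using diff[of x y] diff[of y x] by (cases "x \<le> y") (auto simp: dist_real_def)
  qed simp
  then have "continuous_on {0..1} (\<lambda>x. excess f x / ?I)"
    using E(3) by (intro continuous_intros lipschitz_on_continuous_on) auto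
  then have cont: "continuous_on {0..1} (opT f)"
    by (rule continuous_on_eq) (simp add: val)
  have "convex_on {0..1} (opT f)"
  proof (rule convex_onI)
    fix t x y :: real
    assume t: "0 < t" "t < 1" and xy: "x \<in> {0..1}" "y \<in> {0..1}"
    let ?z = "(1 - t) * x + t * y"
    have z: "?z \<in> {0..1}"
      using convexD_alt[of "{0..1}" x y t] xy t by simp
    have "excess f ?z \<le> integral {0..1} (\<lambda>s. (1 - t) * max 0 (f s - x) + t * max 0 (f s - y))"
      unfolding excess_def
    proof (intro integral_le integrable_add integrable_on_mult_right excess_integrable E)
      fix s
      have "f s - ?z = (1 - t) * (f s - x) + t * (f s - y)"
        by (simp add: algebra_simps)
      moreover have "(1 - t) * (f s - x) \<le> (1 - t) * max 0 (f s - x)"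
          "t * (f s - y) \<le> t * max 0 (f s - y)"
          "0 \<le> (1 - t) * max 0 (f s - x)" "0 \<le> t * max 0 (f s - y)"
        using t by (auto intro!: mult_left_mono mult_nonneg_nonneg)
      ultimately show "max 0 (f s - ?z) \<le> (1 - t) * max 0 (f s - x) + t * max 0 (f s - y)"
        by linarith
    qed
    also have "\<dots> = (1 - t) * excess f x + t * excess f y"
      unfolding excess_def
      by (subst integral_add) (auto intro!: integrable_on_mult_right excess_integrable E)
    finally have "excess f ?z / ?I \<le> ((1 - t) * excess f x + t * excess f y) / ?I"
      using E(3) by (intro divide_right_mono) auto
    then show "opT f ((1 - t) *\<^sub>R x + t *\<^sub>R y) \<le> (1 - t) * opT f x + t * opT f y"
      using val[OF z] val xy by (simp add: add_divide_distrib)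
  qed simp
  then show "opT f \<in> classC_convex"
    using dec nonneg at0 at1 pos cont by (auto simp: classC_convex_def classC_def classE_def)
qed

section \<open>The stride as a pointwise bound\<close>

text \<open>The condition on \<alpha> reads \<open>\<alpha> * (1 - g x) \<le> x\<close>, so it
  passes to smaller \<alpha> and to the supremum, which is finite because \<open>g 1 = 0\<close>
  forces \<open>\<alpha> \<le> 1\<close>.\<close>

lemma stride_ge_iff:
  assumes "g \<in> classC_convex" "s > 0"
  shows "stride g \<ge> s \<longleftrightarrow> (\<forall>x\<in>{0..1}. s - x \<le> s * g x)"
proof -
  let ?A = "{\<alpha>. \<alpha> \<ge> 0 \<and> (\<forall>x\<in>{0..1}. \<alpha> - x \<le> \<alpha> * g x)}"
  have g1: "g 1 = 0"
    using assms by (auto simp: classC_convex_def classC_def)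
  have bdd: "bdd_above ?A"
    using g1 by (intro bdd_aboveI[of _ 1]) (auto dest!: bspec[of _ _ 1])
  show ?thesis
  proof
    assume "\<forall>x\<in>{0..1}. s - x \<le> s * g x"
    then show "stride g \<ge> s"
      unfolding stride_def using assms by (intro cSup_upper bdd) auto
  next
    assume s: "stride g \<ge> s"
    show "\<forall>x\<in>{0..1}. s - x \<le> s * g x"
    proof (rule ballI, rule ccontr)
      fix x assume x: "x \<in> {0..1}" and "\<not> s - x \<le> s * g x"
      then have less: "x < s * (1 - g x)"
        by (simp add: algebra_simps)
      then have pos: "1 - g x > 0"
        using x assms by (metis atLeastAtMost_iff order_le_less_trans zero_less_mult_pos)
      have "x / (1 - g x) < s"
        using less pos by (simp add: pos_divide_less_eq)
      then have "x / (1 - g x) < Sup ?A"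
        using s unfolding stride_def by linarith
      moreover have "0 \<in> ?A"
        by auto
      ultimately obtain \<alpha> where \<alpha>: "\<alpha> \<in> ?A" "x / (1 - g x) < \<alpha>"
        by (metis (no_types, lifting) empty_iff less_cSupE)
      then have "x < \<alpha> * (1 - g x)" "\<alpha> - x \<le> \<alpha> * g x"
        using x pos by (auto simp: pos_divide_less_eq)
      then show False
        by (simp add: right_diff_distrib)
    qed
  qed
qed

section \<open>The integral of the image and its growth\<close>

lemma integral_hinge:
  fixes a :: real
  assumes "0 \<le> a" "a \<le> 1"
  shows "integral {0..1} (\<lambda>x. max 0 (a - x)) = a\<^sup>2 / 2"
proof -
  have "((\<lambda>x. a - x) has_integral (a * a - a\<^sup>2 / 2) - (a * 0 - 0\<^sup>2 / 2)) {0..a}"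
    using assms by (intro fundamental_theorem_of_calculus)
      (auto intro!: derivative_eq_intros simp: has_real_derivative_iff_has_vector_derivative[symmetric])
  then have "((\<lambda>x. max 0 (a - x)) has_integral a\<^sup>2 / 2) {0..a}"
    by (rule has_integral_eq_rhs[OF has_integral_eq[rotated]]) (auto simp: power2_eq_square)
  moreover have "((\<lambda>x. max 0 (a - x)) has_integral 0) {a..1}"
    by (rule has_integral_is_0) auto
  ultimately have "((\<lambda>x. max 0 (a - x)) has_integral a\<^sup>2 / 2 + 0) {0..1}"
    using assms by (intro has_integral_combine[of 0 a 1]) auto
  then show ?thesis
    by (simp add: integral_unique)
qed

text \<open>Integrating \<open>max 0 (g t - x)\<close> over \<open>x\<close> first gives
  \<open>(g t)\<^sup>2 / 2\<close>; continuity of \<open>g\<close> justifies exchanging the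
  integrals.\<close>

lemma intg_opT:
  assumes g: "g \<in> classC"
  shows "intg g * intg (opT g) = integral {0..1} (\<lambda>t. (g t)\<^sup>2) / 2"
proof -
  have E: "g \<in> classE" and cont: "continuous_on {0..1} g"
    using g by (auto simp: classC_def)
  have "continuous_on (cbox (0, 0) (1, 1)) (\<lambda>(x, t). max 0 (g t - x))"
    unfolding split_def cbox_Pair_eq
    by (intro continuous_intros continuous_on_compose2[OF cont]) auto
  from integral_swap_continuous[OF this]
  have "integral {0..1} (excess g) = integral {0..1} (\<lambda>t. integral {0..1} (\<lambda>x. max 0 (g t - x)))"
    unfolding excess_def[abs_def] by simp
  also have "\<dots> = integral {0..1} (\<lambda>t. (g t)\<^sup>2 / 2)"
    using classE_D(5,6)[OF E] by (intro Henstock_Kurzweil_Integration.integral_cong integral_hinge) auto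
  also have "\<dots> = integral {0..1} (\<lambda>t. (g t)\<^sup>2) / 2"
    by simp
  finally have "integral {0..1} (excess g) = integral {0..1} (\<lambda>t. (g t)\<^sup>2) / 2" .
  moreover have "intg (opT g) = integral {0..1} (\<lambda>x. excess g x / intg g)"
    unfolding intg_def[of "opT g"]
    by (intro Henstock_Kurzweil_Integration.integral_cong opT_eq E)
  ultimately show ?thesis
    using classE_D(3)[OF E] by simp
qed

text \<open>The chord inequality with its denominator cleared, so that later uses need no case
  distinction for \<open>x = z\<close>.\<close>

lemma convex_on_three_points:
  fixes g :: "real \<Rightarrow> real"
  assumes "convex_on S g" "x \<in> S" "z \<in> S" "x \<le> y" "y \<le> z"
  shows "(z - x) * g y \<le> (z - y) * g x + (y - x) * g z"
proof (cases "x = z")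
  case False
  define t where "t = (y - x) / (z - x)"
  have "x < z"
    using False assms by simp
  then have t: "0 \<le> t" "t \<le> 1" "(z - x) * t = y - x"
    using assms by (auto simp: t_def)
  have "(1 - t) * x + t * z = x + (z - x) * t"
    by (simp add: algebra_simps)
  then have y: "(1 - t) * x + t * z = y"
    using t by simp
  have "g y \<le> (1 - t) * g x + t * g z"
    using convex_onD[OF assms(1) t(1,2) assms(2,3)] y by simp
  then have "(z - x) * g y \<le> (z - x) * ((1 - t) * g x + t * g z)"
    using \<open>x < z\<close> by (intro mult_left_mono) auto
  also have "\<dots> = ((z - x) - (z - x) * t) * g x + ((z - x) * t) * g z"
    by (simp add: algebra_simps)
  finally show ?thesis
    unfolding t(3) by simp
qed (use assms in auto)

lemma classC_convex_D:
  assumes "g \<in> classC_convex"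
  shows "g \<in> classE" "g \<in> classC" "continuous_on {0..1} g" "convex_on {0..1} g" "g 0 = 1" "g 1 = 0"
  using assms by (auto simp: classC_convex_def classC_def classE_def)

text \<open>With \<open>\<tau> = (51/50)/k\<close>, this is \<open>\<integral>m\<^sup>2 \<ge> 2\<tau> \<integral>m\<close> for \<open>m(x) = max (1 - k x) (c (1 - x))\<close>,
  whose two branches meet at height \<open>y\<close> over \<open>x\<close>.
  Up to a positive factor the difference is a quadratic polynomial in \<open>c\<close>; its discriminant is
  negative because, after the substitution \<open>k = 5 + u\<close>, all coefficients have the same sign.\<close>

lemma broken_line_energy:
  fixes c k :: real
  assumes "k \<ge> 5" "c \<le> 1"
  defines "\<tau> \<equiv> (51/50) / k" and "x \<equiv> (1 - c) / (k - c)" and "y \<equiv> c * (k - 1) / (k - c)"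
  shows "\<tau> * (x + y) \<le> (x * (1 + y) + y\<^sup>2) / 3"
proof -
  \<comment> \<open>Multiplying the claim by \<open>3 * k * (k - c)\<^sup>2\<close> clears the
    denominators of \<open>x\<close>, \<open>y\<close> and \<open>\<tau>\<close>; what remains is
    \<open>A * c\<^sup>2 - B * c + C \<ge> 0\<close>.\<close>
  define A where "A = k^3 - 3 * k\<^sup>2 + (303/50) * k - 306/50"
  define B where "B = (153/50) * k\<^sup>2 - (206/50) * k - 153/50"
  define C where "C = k\<^sup>2 - (153/50) * k"
  define u where "u = k - 5"
  have u: "u \<ge> 0" "k = 5 + u"
    using assms by (auto simp: u_def)
  have A: "A = 74.18 + 51.06 * u + 12 * u\<^sup>2 + u^3"
    unfolding A_def u(2) by (simp add: power2_eq_square power3_eq_cube field_simps)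
  have "4 * A * C - B\<^sup>2 = 86.1184 + 1241.9584 * u + 1155.1744 * u^2 + 414.1024 * u^3 + 66.3964 * u^4 + 4 * u^5"
    unfolding A_def B_def C_def u(2) by algebra
  then have disc: "4 * A * C - B\<^sup>2 \<ge> 0"
    using u by simp
  have "A > 0"
    unfolding A using u by (simp add: add_pos_nonneg)
  have "4 * A * (A * c\<^sup>2 - B * c + C) = (2 * A * c - B)\<^sup>2 + (4 * A * C - B\<^sup>2)"
    by algebra
  also have "\<dots> \<ge> 0"
    using disc by (intro add_nonneg_nonneg) auto
  finally have quad: "A * c\<^sup>2 - B * c + C \<ge> 0"
    using \<open>A > 0\<close> by (simp add: zero_le_mult_iff)
  have pos: "k - c > 0" "k > 0"
    using assms by auto
  have "3 * k * (k - c)\<^sup>2 * ((x * (1 + y) + y\<^sup>2) / 3 - \<tau> * (x + y)) =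
    k * ((k - c) * x * ((k - c) + (k - c) * y) + ((k - c) * y)\<^sup>2)
      - 3 * (k * \<tau>) * (k - c) * ((k - c) * x + (k - c) * y)"
    by (simp add: power2_eq_square field_simps)
  also have "\<dots> = A * c\<^sup>2 - B * c + C"
  proof -
    have eqs: "(k - c) * x = 1 - c" "(k - c) * y = c * (k - 1)" "k * \<tau> = 51/50"
      using pos by (auto simp: x_def y_def \<tau>_def)
    show ?thesis
      unfolding eqs A_def B_def C_def by algebra
  qed
  finally have "3 * k * (k - c)\<^sup>2 * ((x * (1 + y) + y\<^sup>2) / 3 - \<tau> * (x + y)) \<ge> 0"
    using quad by simp
  moreover have "3 * k * (k - c)\<^sup>2 > 0"
    using pos by simp
  ultimately show ?thesis
    by (simp add: zero_le_mult_iff)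
qed

text \<open>Let \<open>g b = \<tau>\<close>. As \<open>t\<^sup>2 - 2\<tau>t\<close> decreases for \<open>t \<le> \<tau>\<close> and increases for \<open>t \<ge> \<tau>\<close>, the integral of
  \<open>g\<^sup>2 - 2\<tau>g\<close> does not increase when \<open>g\<close> is replaced by the maximum of the line \<open>1 - x/s\<close>, which
  bounds \<open>g\<close> from below, and the chord through \<open>(b,\<tau>)\<close> and \<open>(1,0)\<close>, which bounds it from below on
  \<open>[0,b]\<close> and from above on \<open>[b,1]\<close>.\<close>

lemma intg_opT_growth:
  assumes g: "g \<in> classC_convex" and s: "0 < s" "s \<le> 1/5"
    and stride: "\<And>x. x \<in> {0..1} \<Longrightarrow> s - x \<le> s * g x"
  shows "51/50 * s \<le> intg (opT g)"
proof -
  note C = classC_convex_D[OF g]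
  note E = classE_D[OF C(1)]
  define k where "k = 1 / s"
  have k: "k \<ge> 5" "k * s = 1"
    using s by (auto simp: k_def field_simps)
  define \<tau> where "\<tau> = (51/50) / k"
  have \<tau>: "\<tau> = 51/50 * s" "0 < \<tau>" "\<tau> < 1"
    using s by (auto simp: \<tau>_def k_def)
  obtain b where b: "0 \<le> b" "b \<le> 1" "g b = \<tau>"
    using IVT2'[of g 1 \<tau> 0] C \<tau> by auto
  have b1: "b < 1"
    using b C \<tau> by (cases "b = 1") auto
  \<comment> \<open>The chord from (0,1) to (1,0) lies above \<open>g\<close>. This makes
    \<open>c \<le> 1\<close>, as \<open>broken_line_energy\<close> requires.\<close>
  have "\<tau> \<le> 1 - b"
    using convex_on_three_points[OF C(4), of 0 1 b] b C by simp
  define c where "c = \<tau> / (1 - b)"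
  have c: "c \<le> 1" "0 \<le> c" "c * (1 - b) = \<tau>"
    using \<open>\<tau> \<le> 1 - b\<close> b1 \<tau> by (auto simp: c_def)
  have low: "1 - k * x \<le> g x" if "x \<in> {0..1}" for x
  proof -
    have "k * (s - x) \<le> k * (s * g x)"
      using stride[OF that] k by (intro mult_left_mono) auto
    moreover have "k * (s * g x) = g x" "k * (s - x) = 1 - k * x"
      using k by (simp_all add: right_diff_distrib flip: mult.assoc)
    ultimately show ?thesis
      by simp
  qed
  have chord_below: "c * (1 - x) \<le> g x" if "0 \<le> x" "x \<le> b" for x
    using convex_on_three_points[OF C(4), of x 1 b] that b C b1
    by (simp add: c_def field_simps)
  have chord_above: "g x \<le> c * (1 - x)" if "b \<le> x" "x \<le> 1" for x
    using convex_on_three_points[OF C(4), of b 1 x] that b C b1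
    by (simp add: c_def field_simps)
  \<comment> \<open>The lines \<open>1 - k * x\<close> and \<open>c * (1 - x)\<close> meet at
    \<open>(x0, y0)\<close>.\<close>
  define x0 where "x0 = (1 - c) / (k - c)"
  define y0 where "y0 = c * (k - 1) / (k - c)"
  have pos: "k - c > 0"
    using k c by simp
  have x0: "0 \<le> x0" "(k - c) * x0 = 1 - c"
    using pos c by (auto simp: x0_def)
  have y0: "y0 = 1 - k * x0" "y0 = c * (1 - x0)"
    using pos by (auto simp: x0_def y0_def field_simps)
  \<comment> \<open>At \<open>b\<close> the line \<open>1 - k * x\<close> does not exceed
    \<open>g b\<close>, which is the value of the chord there, so the lines cross no later than
    \<open>b\<close> and at a height of at least \<tau>.\<close>
  have "(k - c) * x0 \<le> (k - c) * b"
    using low[of b] b c x0 by (auto simp: algebra_simps)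
  then have "x0 \<le> b"
    using pos by simp
  define \<phi> where "\<phi> t = t\<^sup>2 - 2 * \<tau> * t" for t
  have \<phi>: "\<phi> t \<le> \<phi> t'" if "\<tau> \<le> t \<and> t \<le> t' \<or> t' \<le> t \<and> t \<le> \<tau>" for t t'
  proof -
    have "\<phi> t' - \<phi> t = (t' - t) * ((t - \<tau>) + (t' - \<tau>))"
      by (simp add: \<phi>_def power2_eq_square algebra_simps)
    moreover have "\<dots> \<ge> 0"
      using that by (auto intro: mult_nonneg_nonneg mult_nonpos_nonpos)
    ultimately show ?thesis by simp
  qed
  have int: "(\<lambda>t. \<phi> (g t)) integrable_on {0..1}"
    unfolding \<phi>_def by (intro integrable_continuous_real continuous_intros C)
  have int1: "(\<lambda>t. \<phi> (g t)) integrable_on {0..x0}" and int2: "(\<lambda>t. \<phi> (g t)) integrable_on {x0..1}"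
    using \<open>x0 \<le> b\<close> b x0 by (auto intro: integrable_on_subinterval[OF int])
  \<comment> \<open>\<open>P\<close> and \<open>Q\<close> are antiderivatives of \<phi> along the
    two branches of the broken line.\<close>
  define P where "P x = x - k * x\<^sup>2 + k\<^sup>2 * x^3 / 3 - 2 * \<tau> * (x - k * x\<^sup>2 / 2)" for x
  define Q where "Q x = - c\<^sup>2 * (1 - x)^3 / 3 + \<tau> * c * (1 - x)\<^sup>2" for x
  have P: "((\<lambda>x. \<phi> (1 - k * x)) has_integral P x0 - P 0) {0..x0}"
    unfolding P_def \<phi>_def using x0
    by (intro fundamental_theorem_of_calculus)
      (auto intro!: derivative_eq_intros simp: power2_eq_square algebra_simps
        has_real_derivative_iff_has_vector_derivative[symmetric])
  have Q: "((\<lambda>x. \<phi> (c * (1 - x))) has_integral Q 1 - Q x0) {x0..1}"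
    unfolding Q_def \<phi>_def using \<open>x0 \<le> b\<close> b
    by (intro fundamental_theorem_of_calculus)
      (auto intro!: derivative_eq_intros simp: power2_eq_square field_simps
        has_real_derivative_iff_has_vector_derivative[symmetric])
  have "P x0 - P 0 \<le> integral {0..x0} (\<lambda>t. \<phi> (g t))"
  proof (rule has_integral_le[OF P integrable_integral[OF int1]])
    fix x assume x: "x \<in> {0..x0}"
    have "k * x \<le> k * x0" "c * (1 - b) \<le> c * (1 - x0)"
      using x k c \<open>x0 \<le> b\<close> by (auto intro!: mult_left_mono)
    then have "\<tau> \<le> 1 - k * x"
      using y0 c by simp
    moreover have "1 - k * x \<le> g x"
      using low x \<open>x0 \<le> b\<close> b by auto
    ultimately show "\<phi> (1 - k * x) \<le> \<phi> (g x)"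
      by (intro \<phi>) auto
  qed
  moreover have "Q 1 - Q x0 \<le> integral {x0..1} (\<lambda>t. \<phi> (g t))"
  proof (rule has_integral_le[OF Q integrable_integral[OF int2]])
    fix x assume x: "x \<in> {x0..1}"
    show "\<phi> (c * (1 - x)) \<le> \<phi> (g x)"
    proof (rule \<phi>, cases "x \<le> b")
      case True
      then have "c * (1 - b) \<le> c * (1 - x)"
        using c by (intro mult_left_mono) auto
      then show "\<tau> \<le> c * (1 - x) \<and> c * (1 - x) \<le> g x \<or> g x \<le> c * (1 - x) \<and> c * (1 - x) \<le> \<tau>"
        using chord_below[of x] x x0 True c by auto
    next
      case False
      then have "c * (1 - x) \<le> c * (1 - b)"
        using c by (intro mult_left_mono) auto
      then show "\<tau> \<le> c * (1 - x) \<and> c * (1 - x) \<le> g x \<or> g x \<le> c * (1 - x) \<and> c * (1 - x) \<le> \<tau>"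
        using chord_above[of x] x x0 False c by auto
    qed
  qed
  moreover have "(P x0 - P 0) + (Q 1 - Q x0) = (x0 * (1 + y0) + y0\<^sup>2) / 3 - \<tau> * (x0 + y0)"
  proof -
    have "P x0 - P 0 = x0 * (1 + (1 - k * x0) + (1 - k * x0)\<^sup>2) / 3 - \<tau> * x0 * (1 + (1 - k * x0))"
      unfolding P_def by (simp add: power2_eq_square power3_eq_cube field_simps)
    moreover have "Q 1 - Q x0 = (1 - x0) * (c * (1 - x0))\<^sup>2 / 3 - \<tau> * (1 - x0) * (c * (1 - x0))"
      unfolding Q_def by (simp add: power2_eq_square power3_eq_cube)
    ultimately show ?thesis
      unfolding y0(1)[symmetric] y0(2)[symmetric] by (simp add: power2_eq_square field_simps)
  qed
  moreover have "integral {0..x0} (\<lambda>t. \<phi> (g t)) + integral {x0..1} (\<lambda>t. \<phi> (g t))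
      = integral {0..1} (\<lambda>t. \<phi> (g t))"
    using x0 \<open>x0 \<le> b\<close> b int by (intro Henstock_Kurzweil_Integration.integral_combine) auto
  moreover have "\<tau> * (x0 + y0) \<le> (x0 * (1 + y0) + y0\<^sup>2) / 3"
    unfolding \<tau>_def x0_def y0_def using k c by (intro broken_line_energy) auto
  ultimately have "0 \<le> integral {0..1} (\<lambda>t. \<phi> (g t))"
    by linarith
  also have "\<dots> = integral {0..1} (\<lambda>t. (g t)\<^sup>2) - 2 * \<tau> * intg g"
    unfolding \<phi>_def intg_def
    by (subst integral_diff) (auto intro!: integrable_continuous_real continuous_intros C)
  also have "\<dots> = 2 * intg g * (intg (opT g) - \<tau>)"
    using intg_opT[OF C(2)] by (simp add: algebra_simps)
  finally show ?thesis
    using E(3) \<tau>(1) by (simp add: zero_le_mult_iff)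
qed

section \<open>Regularity of the image of the operator\<close>

text \<open>Continuity puts the supremum into the closed superlevel set; a point with value exactly
  \<open>y\<close>, which lies to its left, then forces equality.\<close>

lemma gstar_attained:
  assumes "g \<in> classC" "y \<in> {0..1}"
  shows "gstar g y \<in> {0..1}" "g (gstar g y) = y"
proof -
  have E: "g \<in> classE" and cont: "continuous_on {0..1} g" and g1: "g 1 = 0"
    using assms by (auto simp: classC_def)
  note D = classE_D[OF E]
  let ?A = "{x \<in> {0..1}. y \<le> g x}"
  have "closed ?A"
    by (intro continuous_on_closed_Collect_le continuous_intros cont)
  moreover have "0 \<in> ?A"
    using D(2) assms by auto
  moreover have "bdd_above ?A"
    by (auto intro!: bdd_aboveI[of _ 1])
  ultimately have "gstar g y \<in> ?A"
    unfolding gstar_def using closed_contains_Sup[of ?A] by blast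
  then show in01: "gstar g y \<in> {0..1}" and ge: "g (gstar g y) = y"
  proof -
    obtain x where x: "0 \<le> x" "x \<le> 1" "g x = y"
      using IVT2'[of g 1 y 0] cont g1 D(2) assms by auto
    then have "x \<le> gstar g y"
      by (intro gstar_upper) auto
    then have "g (gstar g y) \<le> y"
      using D(1) x \<open>gstar g y \<in> ?A\<close> by (auto simp: decreasing01_def)
    then show "gstar g y \<in> {0..1}" "g (gstar g y) = y"
      using \<open>gstar g y \<in> ?A\<close> by auto
  qed
qed

text \<open>The chord from \<open>(gstar g y', y')\<close> to \<open>(1, 0)\<close> lies above
  \<open>g\<close>. So \<open>g\<close> is steep where it is positive, and \<open>gstar g\<close> is
  Lipschitz away from 0.\<close>

lemma gstar_increment:
  assumes g: "g \<in> classC_convex" and y: "0 \<le> y" "y \<le> y'" "y' \<le> 1"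
  shows "y * (gstar g y - gstar g y') \<le> y' - y"
proof -
  note C = classC_convex_D[OF g]
  let ?u = "gstar g y" and ?v = "gstar g y'"
  have u: "?u \<in> {0..1}" "g ?u = y" and v: "?v \<in> {0..1}" "g ?v = y'"
    using gstar_attained[OF C(2)] y by auto
  have "?v \<le> ?u"
    using y by (intro gstar_antimono C) auto
  then have "(1 - ?v) * y \<le> (1 - ?u) * y'"
    using convex_on_three_points[OF C(4), of ?v 1 ?u] u v C by auto
  then have "y * (?u - ?v) \<le> (1 - ?u) * (y' - y)"
    by (simp add: algebra_simps)
  also have "\<dots> \<le> 1 * (y' - y)"
    using u y by (intro mult_right_mono) auto
  finally show ?thesis by simp
qed

lemma gstar_tendsto:
  assumes g: "g \<in> classC_convex" and y: "y \<in> {0<..1}"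
  shows "(gstar g \<longlongrightarrow> gstar g y) (at y within {0..1})"
proof -
  note C = classC_convex_D[OF g]
  have "((\<lambda>z. gstar g z - gstar g y) \<longlongrightarrow> 0) (at y within {0..1})"
  proof (rule Lim_null_comparison)
    have bound: "norm (gstar g z - gstar g y) \<le> 2 / y * \<bar>z - y\<bar>" if z: "z \<in> {0..1}" "y / 2 < z" for z
    proof -
      have "min y z * \<bar>gstar g z - gstar g y\<bar> \<le> \<bar>z - y\<bar>"
        using gstar_increment[OF g, of y z] gstar_increment[OF g, of z y]
          gstar_antimono[OF C(1), of y z] gstar_antimono[OF C(1), of z y] y z
        by (cases "y \<le> z") (auto simp: min_def abs_if)
      moreover have "y / 2 * \<bar>gstar g z - gstar g y\<bar> \<le> min y z * \<bar>gstar g z - gstar g y\<bar>"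
        using y z by (intro mult_right_mono) auto
      ultimately have "y / 2 * \<bar>gstar g z - gstar g y\<bar> \<le> \<bar>z - y\<bar>"
        by linarith
      then show ?thesis
        using y by (simp add: field_simps)
    qed
    have "\<forall>\<^sub>F z in at y within {0..1}. y / 2 < z"
      using y by (intro order_tendstoD(1)[OF tendsto_ident_at]) auto
    moreover have "\<forall>\<^sub>F z in at y within {0..1}. z \<in> {0..1}"
      by (simp add: eventually_at_filter)
    ultimately show "\<forall>\<^sub>F z in at y within {0..1}. norm (gstar g z - gstar g y) \<le> 2 / y * \<bar>z - y\<bar>"
      by eventually_elim (rule bound)
    have "((\<lambda>z. 2 / y * \<bar>z - y\<bar>) \<longlongrightarrow> 2 / y * \<bar>y - y\<bar>) (at y within {0..1})"
      by (intro tendsto_intros)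
    then show "((\<lambda>z. 2 / y * \<bar>z - y\<bar>) \<longlongrightarrow> 0) (at y within {0..1})"
      by simp
  qed
  then show ?thesis
    by (simp add: LIM_zero_iff)
qed

text \<open>By \<open>excess_diff\<close> the difference quotient lies between
  \<open>- gstar f x\<close> and \<open>- gstar f y\<close>.\<close>

lemma excess_has_derivative:
  assumes f: "f \<in> classE" and x: "x \<in> {0..1}"
    and lim: "(gstar f \<longlongrightarrow> gstar f x) (at x within {0..1})"
  shows "(excess f has_real_derivative - gstar f x) (at x within {0..1})"
proof -
  have "((\<lambda>y. (excess f y - excess f x) / (y - x) - (- gstar f x)) \<longlongrightarrow> 0) (at x within {0..1})"
  proof (rule Lim_null_comparison)
    have "norm ((excess f y - excess f x) / (y - x) - (- gstar f x)) \<le> \<bar>gstar f y - gstar f x\<bar>"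
      if y: "y \<in> {0..1}" "y \<noteq> x" for y
    proof -
      have "\<bar>(excess f y - excess f x) + (y - x) * gstar f x\<bar> \<le> \<bar>y - x\<bar> * \<bar>gstar f y - gstar f x\<bar>"
      proof (cases "x \<le> y")
        case True
        then have "\<bar>y - x\<bar> * \<bar>gstar f y - gstar f x\<bar> = (y - x) * gstar f x - (y - x) * gstar f y"
          using gstar_antimono[OF f True] y by (simp add: right_diff_distrib)
        then show ?thesis
          using excess_diff[OF f True] y by (intro abs_leI; (unfold atLeastAtMost_iff, linarith))
      next
        case False
        then have "\<bar>y - x\<bar> * \<bar>gstar f y - gstar f x\<bar> = (x - y) * gstar f y - (x - y) * gstar f x"
          using gstar_antimono[OF f, of y x] x by (simp add: right_diff_distrib)
        moreover have "(y - x) * gstar f x = - ((x - y) * gstar f x)"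
          by (simp add: left_diff_distrib)
        moreover have "(x - y) * gstar f x \<le> excess f y - excess f x"
            "excess f y - excess f x \<le> (x - y) * gstar f y"
          using False x by (intro excess_diff f; simp)+
        ultimately show ?thesis
          by linarith
      qed
      moreover have "(excess f y - excess f x) / (y - x) - (- gstar f x)
          = ((excess f y - excess f x) + (y - x) * gstar f x) / (y - x)"
        using y by (simp add: add_divide_distrib)
      ultimately show ?thesis
        using y by (simp add: abs_divide pos_divide_le_eq mult.commute)
    qed
    then show "\<forall>\<^sub>F y in at x within {0..1}.
        norm ((excess f y - excess f x) / (y - x) - (- gstar f x)) \<le> \<bar>gstar f y - gstar f x\<bar>"
      by (simp add: eventually_at_filter)
    show "((\<lambda>y. \<bar>gstar f y - gstar f x\<bar>) \<longlongrightarrow> 0) (at x within {0..1})"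
      using tendsto_rabs_zero LIM_zero lim by blast
  qed
  then show ?thesis
    unfolding has_field_derivative_iff by (simp only: LIM_zero_iff)
qed

text \<open>Supplies the limit at 0 of the derivative of \<open>opT g\<close>. The value
  \<open>gstar g 0 = 1\<close> would not do: the limit of \<open>gstar g\<close> is smaller if
  \<open>g\<close> vanishes before 1.\<close>

lemma antimono_tendsto_at_right:
  fixes G :: "real \<Rightarrow> real"
  assumes anti: "\<And>x y. 0 < x \<Longrightarrow> x \<le> y \<Longrightarrow> y \<le> 1 \<Longrightarrow> G y \<le> G x"
    and bound: "\<And>x. 0 < x \<Longrightarrow> x \<le> 1 \<Longrightarrow> G x \<le> M"
  shows "(G \<longlongrightarrow> Sup (G ` {0<..1})) (at_right 0)"
proof (rule order_tendstoI)
  have bdd: "bdd_above (G ` {0<..1})"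
    using bound by (auto intro!: bdd_aboveI[of _ M])
  have ev: "\<forall>\<^sub>F y in at_right 0. y \<in> {0<..<d}" if "d > 0" for d :: real
    using that by (rule eventually_at_right_real)
  show "\<forall>\<^sub>F y in at_right 0. a < G y" if a: "a < Sup (G ` {0<..1})" for a
  proof -
    have "G ` {0<..1} \<noteq> {}"
      by simp
    then obtain w where "w \<in> G ` {0<..1}" "a < w"
      using less_cSupE[OF a] by blast
    then obtain z where z: "0 < z" "z \<le> 1" "a < G z"
      by auto
    show ?thesis
      using ev[OF z(1)]
    proof eventually_elim
      case (elim y)
      then have "G z \<le> G y"
        using z by (intro anti) auto
      then show ?case using z by simp
    qed
  qed
  show "\<forall>\<^sub>F y in at_right 0. G y < a" if a: "Sup (G ` {0<..1}) < a" for a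
    using ev[OF zero_less_one]
  proof eventually_elim
    case (elim y)
    then have "G y \<le> Sup (G ` {0<..1})"
      by (intro cSup_upper bdd) auto
    then show ?case using a by simp
  qed
qed

text \<open>The derivative of \<open>opT g\<close> is \<open>- gstar g / intg g\<close>, so the
  claims reduce to continuity of \<open>gstar g\<close> on \<open>{0<..1}\<close>, its vanishing at
  1 and its positivity below 1.\<close>

lemma opT_sharp:
  assumes g: "g \<in> classC_convex"
  shows "opT g \<in> classD_sharp_convex"
proof -
  note C = classC_convex_D[OF g]
  note E = classE_D[OF C(1)]
  let ?h' = "\<lambda>x. - gstar g x / intg g"
  have deriv: "(opT g has_real_derivative ?h' x) (at x within {0..1})" if x: "x \<in> {0<..1}" for x
  proof (rule has_field_derivative_transform_within)
    show "((\<lambda>x. excess g x / intg g) has_real_derivative ?h' x) (at x within {0..1})"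
      using x by (intro DERIV_cdivide excess_has_derivative gstar_tendsto C g) auto
    show "excess g y / intg g = opT g y" if "y \<in> {0..1}" for y
      using opT_eq[OF C(1) that] by simp
  qed (use x in auto)
  have "continuous_on {0<..1} (gstar g)"
    unfolding continuous_on_def
    by (auto intro!: tendsto_within_subset[OF gstar_tendsto[OF g]])
  then have "continuous_on {0<..1} ?h'"
    using E(3) by (intro continuous_intros) auto
  then have C1: "C1_deriv01 (opT g) ?h'"
    using deriv by (simp add: C1_deriv01_def)
  \<comment> \<open>Convexity gives \<open>g x \<le> 1 - x\<close>, so \<open>g\<close> takes the
    value 1 only at 0.\<close>
  have "gstar g 1 \<le> 0"
    using convex_on_three_points[OF C(4), of 0 1 "gstar g 1"] gstar_attained[OF C(2), of 1] C
    by simp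
  then have "?h' 1 = 0"
    using gstar_bounds[OF C(1), of 1] by simp
  moreover have "\<exists>L. L \<le> 0 \<and> (?h' \<longlongrightarrow> L) (at_right 0)"
  proof (intro exI conjI)
    let ?S = "Sup (gstar g ` {0<..1})"
    have "(gstar g \<longlongrightarrow> ?S) (at_right 0)"
      using gstar_bounds[OF C(1)] gstar_antimono[OF C(1)]
      by (intro antimono_tendsto_at_right[where M = 1]) auto
    then show "(?h' \<longlongrightarrow> - ?S / intg g) (at_right 0)"
      using E(3) by (intro tendsto_intros) auto
    have "gstar g 1 \<le> ?S"
      using gstar_bounds[OF C(1)] by (intro cSup_upper) (auto intro!: bdd_aboveI[of _ 1])
    then show "- ?S / intg g \<le> 0"
      using gstar_bounds[OF C(1), of 1] E(3) by simp
  qed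
  moreover have "strictly_decreasing01 (opT g)"
    unfolding strictly_decreasing01_def
  proof (intro ballI impI)
    fix x y :: real assume xy: "x \<in> {0..1}" "y \<in> {0..1}" "x < y"
    \<comment> \<open>The midpoint stays below 1, where \<open>gstar g\<close> is positive; at
      \<open>y = 1\<close> it would vanish.\<close>
    define m where "m = (x + y) / 2"
    have m: "x < m" "m < y" "m \<in> {0..1}" "m < 1"
      using xy by (auto simp: m_def)
    have "gstar g m \<noteq> 0"
      using gstar_attained[OF C(2) m(3)] m C by auto
    then have "0 < (m - x) * gstar g m"
      using m gstar_bounds[OF C(1), of m] by simp
    then have "excess g m < excess g x"
      using excess_diff(1)[OF C(1), of x m] m by simp
    moreover have "excess g y \<le> excess g m"
    proof -
      have "0 \<le> (y - m) * gstar g y"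
        using m xy gstar_bounds[OF C(1), of y] by (intro mult_nonneg_nonneg) auto
      also have "\<dots> \<le> excess g m - excess g y"
        using m xy by (intro excess_diff(1) C) auto
      finally show ?thesis by simp
    qed
    ultimately show "opT g y < opT g x"
      using xy E(3) by (simp add: opT_eq[OF C(1)] divide_strict_right_mono)
  qed
  ultimately show ?thesis
    using C1 opT_class(1)[OF C(1)]
    by (auto simp: classD_sharp_convex_def classD_sharp_def classD_def classC_convex_def)
qed

section \<open>Invariance and absorption\<close>

lemma classK_iff:
  "g \<in> classK \<longleftrightarrow> g \<in> classC_convex \<and> (\<forall>x\<in>{0..1}. 1/5 - x \<le> 1/5 * g x) \<and> 1/5 \<le> intg g"
  using stride_ge_iff[of g "1/5"] by (auto simp: classK_def)

lemma stride_bound_antimono: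
  assumes g: "g \<in> classC_convex" and st: "\<forall>x\<in>{0..1}. s - x \<le> s * g x" and r: "0 < r" "r \<le> s"
  shows "\<forall>x\<in>{0..1}. r - x \<le> r * g x"
  using stride_ge_iff[OF g, of s] stride_ge_iff[OF g, of r] st r by auto

text \<open>The two conditions exchange roles: the integral of \<open>g\<close> bounds the stride of
  \<open>opT g\<close>, and the stride of \<open>g\<close> bounds the integral of
  \<open>opT g\<close>.\<close>

lemma opT_classK:
  assumes "g \<in> classK"
  shows "opT g \<in> classK"
proof -
  have g: "g \<in> classC_convex" and st: "\<forall>x\<in>{0..1}. 1/5 - x \<le> 1/5 * g x" and int: "1/5 \<le> intg g"
    using assms by (auto simp: classK_iff)
  note E = classC_convex_D(1)[OF g]
  have "\<forall>x\<in>{0..1}. 1/5 - x \<le> 1/5 * opT g x"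
    by (rule stride_bound_antimono[OF opT_class(1)[OF E] ballI[OF opT_class(2)[OF E]]])
      (use int in auto)
  moreover have "1/5 \<le> intg (opT g)"
    using intg_opT_growth[OF g, of "1/5"] st by simp
  ultimately show ?thesis
    using opT_class(1)[OF E] by (simp add: classK_iff)
qed

text \<open>The bound on the stride improves by the factor 51/50 under two steps of the operator, so two
  consecutive iterates are followed simultaneously.\<close>

lemma opT_absorbed:
  assumes f: "f \<in> classE"
  shows "\<exists>n\<ge>1. (opT ^^ n) f \<in> classK"
proof -
  define G where "G n = (opT ^^ n) f" for n
  have G_Suc: "G (Suc n) = opT (G n)" for n
    by (simp add: G_def)
  have GE: "G n \<in> classE" for n
  proof (induction n)
    case 0
    then show ?case using f by (simp add: G_def)
  next
    case (Suc n)
    then show ?case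
      unfolding G_Suc by (intro classC_convex_D(1) opT_class(1)[OF Suc.IH])
  qed
  have GC: "G (Suc n) \<in> classC_convex" for n
    unfolding G_Suc by (intro opT_class(1) GE)
  \<comment> \<open>For \<open>s > 0\<close> and \<open>n \<ge> 1\<close> this says that the stride
    of \<open>G n\<close> is at least \<open>s\<close>. The indices \<open>Suc n\<close> below leave
    out \<open>G 0 = f\<close>, which need not be convex.\<close>
  define W where "W s n \<longleftrightarrow> (\<forall>x\<in>{0..1}. s - x \<le> s * G n x)" for s n
  have W_mono: "W r (Suc n)" if "W s (Suc n)" "0 < r" "r \<le> s" for r s n
    using stride_bound_antimono[OF GC] that unfolding W_def by blast
  have W_Suc: "W (intg (G n)) (Suc n)" for n
    unfolding W_def G_Suc using opT_class(2)[OF GE] by blast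
  have growth: "51/50 * s \<le> intg (G (Suc (Suc n)))" if "W s (Suc n)" "0 < s" "s \<le> 1/5" for s n
    using intg_opT_growth[OF GC that(2,3)] that(1) unfolding W_def G_Suc by blast
  \<comment> \<open>By \<open>W_Suc\<close> these integrals bound the strides of \<open>G 1\<close>
    and \<open>G 2\<close>; the cap 1/5 is the range in which \<open>growth\<close> applies.\<close>
  define s where "s = min (1/5) (min (intg (G 0)) (intg (G 1)))"
  have s: "0 < s" "s \<le> 1/5"
    using classE_D(3)[OF GE] by (auto simp: s_def)
  define a where "a j = min (1/5) ((51/50)^j * s)" for j :: nat
  have a: "0 < a j" "a j \<le> 1/5" "a (Suc j) \<le> 51/50 * a j" for j
  proof -
    define p where "p = (51/50)^j * s"
    have "p > 0" "a j = min (1/5) p" "a (Suc j) = min (1/5) (51/50 * p)"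
      using s by (simp_all add: a_def p_def)
    then show "0 < a j" "a j \<le> 1/5" "a (Suc j) \<le> 51/50 * a j"
      by linarith+
  qed
  \<comment> \<open>The stride of one iterate bounds the integral of the next, which in turn bounds
    the stride of the one after.\<close>
  have step: "W (a (Suc j)) (Suc (Suc (Suc n)))" if "W (a j) (Suc n)" for j n
    by (intro W_mono[OF W_Suc a(1)] order_trans[OF a(3) growth[OF that a(1,2)]])
  have W_both: "W (a j) (Suc (2 * j)) \<and> W (a j) (Suc (Suc (2 * j)))" for j
  proof (induction j)
    case 0
    have "a 0 = s" "s \<le> intg (G 0)" "s \<le> intg (G 1)"
      using s by (auto simp: a_def s_def)
    then show ?case
      using W_mono[OF W_Suc[of 0], of s] W_mono[OF W_Suc[of 1], of s] s by simp
  next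
    case (Suc j)
    then show ?case
      using step by simp
  qed
  obtain j where "1/5 / s < (51/50 :: real) ^ j"
    using real_arch_pow[of "51/50" "1/5 / s"] by auto
  then have "a j = 1/5"
    using s by (simp add: a_def field_simps)
  then have W1: "W (1/5) (Suc (2 * j))" and W2: "W (1/5) (Suc (Suc (2 * j)))"
    using W_both[of j] unfolding \<open>a j = 1/5\<close> by blast+
  \<comment> \<open>\<open>W1\<close> yields the integral bound for the next iterate, whose own
    stride bound is \<open>W2\<close>.\<close>
  have "1/5 \<le> intg (G (Suc (Suc (2 * j))))"
    using growth[OF W1] by simp
  then have "G (Suc (Suc (2 * j))) \<in> classK"
    using W2 GC by (simp add: classK_iff W_def)
  then show ?thesis
    unfolding G_def by (intro exI[of _ "Suc (Suc (2 * j))"]) simp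
qed

section \<open>The two metrics on K\<close>

lemma classK_D:
  assumes "g \<in> classK"
  shows "g \<in> classE" "g \<in> classC_convex" "continuous_on {0..1} g" "1/5 \<le> intg g"
  using assms classC_convex_D[of g] by (auto simp: classK_iff)

text \<open>A convex function falls over \<open>{x..y}\<close> at most as fast as on average over
  \<open>{0..y}\<close>, and the stride bounds that average by 5.\<close>

lemma classK_slope:
  assumes K: "g \<in> classK" and xy: "0 \<le> x" "x \<le> y" "y \<le> 1"
  shows "0 \<le> g x - g y" "g x - g y \<le> 5 * (y - x)"
proof -
  note C = classC_convex_D[OF classK_D(2)[OF K]]
  show "0 \<le> g x - g y"
    using classE_D(1)[OF C(1)] xy by (auto simp: decreasing01_def)
  have "1/5 - y \<le> 1/5 * g y"
    using K xy by (auto simp: classK_iff)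
  then have *: "1 - g y \<le> 5 * y"
    by simp
  show "g x - g y \<le> 5 * (y - x)"
  proof (cases "y = 0")
    case False
    have "y * g x \<le> (y - x) + x * g y"
      using convex_on_three_points[OF C(4), of 0 y x] xy C by simp
    then have "y * (g x - g y) \<le> (y - x) * (1 - g y)"
      by (simp add: algebra_simps)
    also have "\<dots> \<le> (y - x) * (5 * y)"
      using * xy by (intro mult_left_mono) auto
    finally have "y * (g x - g y) \<le> y * (5 * (y - x))"
      by (simp add: mult_ac)
    then show ?thesis
      using False xy by simp
  qed (use xy in simp)
qed

text \<open>Both slopes lie in \<open>{-5..0}\<close>, so the constant for the difference is 5
  rather than 10.\<close>

lemma classK_diff_lipschitz:
  assumes "f \<in> classK" "g \<in> classK" "x \<in> {0..1}" "t \<in> {0..1}"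
  shows "\<bar>f x - g x\<bar> \<le> \<bar>f t - g t\<bar> + 5 * \<bar>x - t\<bar>"
proof (cases "x \<le> t")
  case True
  then show ?thesis
    using classK_slope[OF assms(1), of x t] classK_slope[OF assms(2), of x t] assms(3,4) by auto
next
  case False
  then show ?thesis
    using classK_slope[OF assms(1), of t x] classK_slope[OF assms(2), of t x] assms(3,4) by auto
qed

lemma abs_diff_le_d_inf:
  assumes "continuous_on {0..1} f" "continuous_on {0..1} g" "x \<in> {0..1}"
  shows "\<bar>f x - g x\<bar> \<le> d_inf f g"
proof -
  have "compact ((\<lambda>x. \<bar>f x - g x\<bar>) ` {0..1})"
    by (intro compact_continuous_image continuous_intros assms) auto
  then have "bdd_above ((\<lambda>x. \<bar>f x - g x\<bar>) ` {0..1})"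
    by (intro bounded_imp_bdd_above compact_imp_bounded)
  then show ?thesis
    unfolding d_inf_def using assms(3) by (intro cSup_upper) auto
qed

lemma d_inf_le:
  assumes "\<And>x. x \<in> {0..1} \<Longrightarrow> \<bar>f x - g x\<bar> \<le> c"
  shows "d_inf f g \<le> c"
  unfolding d_inf_def using assms by (intro cSup_least) auto

lemma abs_diff_integrable:
  fixes f g :: "real \<Rightarrow> real"
  assumes "continuous_on {0..1} f" "continuous_on {0..1} g"
  shows "(\<lambda>x. \<bar>f x - g x\<bar>) integrable_on {0..1}"
  using assms by (intro integrable_continuous_real continuous_intros)

lemma d_1_nonneg:
  assumes "continuous_on {0..1} f" "continuous_on {0..1} g"
  shows "0 \<le> d_1 f g"
  unfolding d_1_def using abs_diff_integrable[OF assms] by (intro integral_nonneg) auto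

lemma d_1_le_d_inf:
  assumes "continuous_on {0..1} f" "continuous_on {0..1} g"
  shows "d_1 f g \<le> d_inf f g"
proof -
  have "d_1 f g \<le> integral {0..1} (\<lambda>x::real. d_inf f g)"
    unfolding d_1_def using abs_diff_integrable[OF assms] abs_diff_le_d_inf[OF assms]
    by (intro integral_le) auto
  then show ?thesis by simp
qed

text \<open>A gap \<delta> at \<open>x\<close> stays at least \<open>\<delta> / 2\<close> on an
  interval of length \<open>\<delta> / 10\<close>, so \<open>d_1 f g\<close> is at least
  \<open>\<delta>\<^sup>2 / 20\<close>; enlarging 20 to 25 gives the factor 5.\<close>

lemma d_inf_le_sqrt_d_1:
  assumes K: "f \<in> classK" "g \<in> classK"
  shows "d_inf f g \<le> 5 * sqrt (d_1 f g)"
proof (rule d_inf_le)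
  fix x :: real assume x: "x \<in> {0..1}"
  define \<delta> where "\<delta> = \<bar>f x - g x\<bar>"
  have \<delta>: "0 \<le> \<delta>" "\<delta> \<le> 1"
    using classE_D(5,6)[OF classK_D(1)[OF K(1)] x] classE_D(5,6)[OF classK_D(1)[OF K(2)] x]
    by (auto simp: \<delta>_def)
  have near: "\<delta> / 2 \<le> \<bar>f t - g t\<bar>" if "t \<in> {0..1}" "\<bar>x - t\<bar> \<le> \<delta> / 10" for t
    using classK_diff_lipschitz[OF K x that(1)] that(2) by (simp add: \<delta>_def)
  \<comment> \<open>The interval extends to the side of \<open>x\<close> with more room, where
    \<open>\<delta> / 10\<close> fits because \<open>\<delta> \<le> 1\<close>.\<close>
  obtain a b where ab: "0 \<le> a" "a \<le> b" "b \<le> 1" "b - a = \<delta> / 10"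
    "\<And>t. t \<in> {a<..<b} \<Longrightarrow> \<bar>x - t\<bar> \<le> \<delta> / 10"
  proof (cases "x \<le> 1/2")
    case True
    show ?thesis
      by (rule that[of x "x + \<delta> / 10"]) (use True x \<delta> in auto)
  next
    case False
    show ?thesis
      by (rule that[of "x - \<delta> / 10" x]) (use False x \<delta> in auto)
  qed
  have "\<delta> / 2 * (b - a) \<le> d_1 f g"
    unfolding d_1_def
  proof (rule integral_unit_ge_strip)
    show "\<delta> / 2 \<le> \<bar>f t - g t\<bar>" if "t \<in> {a<..<b}" for t
      using near[of t] ab that by auto
  qed (use ab abs_diff_integrable K classK_D(3) in auto)
  then have "\<delta>\<^sup>2 \<le> 20 * d_1 f g"
    by (simp add: ab power2_eq_square)
  also have "\<dots> \<le> 25 * d_1 f g"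
    using d_1_nonneg K classK_D(3) by simp
  also have "\<dots> = (5 * sqrt (d_1 f g))\<^sup>2"
    using d_1_nonneg K classK_D(3) by (simp add: power_mult_distrib)
  finally show "\<bar>f x - g x\<bar> \<le> 5 * sqrt (d_1 f g)"
    unfolding \<delta>_def by (rule power2_le_imp_le) (simp add: d_1_nonneg K classK_D(3))
qed

lemma d_inf_triangle:
  assumes "continuous_on {0..1} f" "continuous_on {0..1} g" "continuous_on {0..1} h"
  shows "d_inf f h \<le> d_inf f g + d_inf g h"
proof (rule d_inf_le)
  fix x :: real assume "x \<in> {0..1}"
  then show "\<bar>f x - h x\<bar> \<le> d_inf f g + d_inf g h"
    using abs_diff_le_d_inf[OF assms(1,2), of x] abs_diff_le_d_inf[OF assms(2,3), of x] by linarith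
qed

lemma d_1_triangle:
  assumes "continuous_on {0..1} f" "continuous_on {0..1} g" "continuous_on {0..1} h"
  shows "d_1 f h \<le> d_1 f g + d_1 g h"
proof -
  have "d_1 f h \<le> integral {0..1} (\<lambda>x. \<bar>f x - g x\<bar> + \<bar>g x - h x\<bar>)"
    unfolding d_1_def using assms
    by (intro integral_le integrable_add abs_diff_integrable) auto
  also have "\<dots> = d_1 f g + d_1 g h"
    unfolding d_1_def using assms by (intro integral_add abs_diff_integrable)
  finally show ?thesis .
qed

section \<open>Completeness and compactness of K\<close>

text \<open>A Cauchy sequence with a convergent subsequence converges to the same limit.\<close>

lemma complete_wrt_if_seq_compact:
  assumes comp: "seq_compact_wrt S d"
    and nonneg: "\<And>f g. f \<in> S \<Longrightarrow> g \<in> S \<Longrightarrow> 0 \<le> d f g"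
    and tri: "\<And>f g h. f \<in> S \<Longrightarrow> g \<in> S \<Longrightarrow> h \<in> S \<Longrightarrow> d f h \<le> d f g + d g h"
  shows "complete_wrt S d"
  unfolding complete_wrt_def
proof (intro allI impI, elim conjE)
  fix u :: "nat \<Rightarrow> real \<Rightarrow> real"
  assume u: "\<forall>n. u n \<in> S" and cauchy: "\<forall>e>0. \<exists>N. \<forall>m\<ge>N. \<forall>n\<ge>N. d (u m) (u n) < e"
  obtain r :: "nat \<Rightarrow> nat" and g where r: "strict_mono r" and g: "g \<in> S"
    and lim: "(\<lambda>n. d (u (r n)) g) \<longlonglongrightarrow> 0"
    using comp u unfolding seq_compact_wrt_def by blast
  have "(\<lambda>n. d (u n) g) \<longlonglongrightarrow> 0"
  proof (rule LIMSEQ_I)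
    fix e :: real assume "e > 0"
    then have "\<exists>N. \<forall>m\<ge>N. \<forall>n\<ge>N. d (u m) (u n) < e / 2"
      by (intro cauchy[rule_format]) simp
    then obtain N where N: "\<And>m n. m \<ge> N \<Longrightarrow> n \<ge> N \<Longrightarrow> d (u m) (u n) < e / 2"
      by blast
    obtain M where M: "\<And>n. n \<ge> M \<Longrightarrow> d (u (r n)) g < e / 2"
      using order_tendstoD(2)[OF lim, of "e / 2"] \<open>e > 0\<close> by (auto simp: eventually_sequentially)
    define k where "k = max N M"
    have "r k \<ge> N"
      using seq_suble[OF r, of k] by (simp add: k_def)
    have "norm (d (u n) g - 0) < e" if "n \<ge> N" for n
    proof -
      have "d (u n) g \<le> d (u n) (u (r k)) + d (u (r k)) g"
        using u g by (intro tri) auto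
      also have "\<dots> < e / 2 + e / 2"
        using N[OF that \<open>r k \<ge> N\<close>] M[of k] by (intro add_strict_mono) (auto simp: k_def)
      finally show ?thesis
        using nonneg u g by simp
    qed
    then show "\<exists>N. \<forall>n\<ge>N. norm (d (u n) g - 0) < e"
      by blast
  qed
  then show "\<exists>g\<in>S. (\<lambda>n. d (u n) g) \<longlonglongrightarrow> 0"
    using g by blast
qed

text \<open>All defining conditions are closed: monotonicity, convexity, the endpoint values and the
  stride bound under pointwise limits, continuity and the integral bound by uniformity.\<close>

lemma classK_uniform_limit:
  assumes u: "\<And>n::nat. u n \<in> classK" and lim: "uniform_limit {0..1} u g sequentially"
  shows "g \<in> classK"
proof -
  note C = classC_convex_D[OF classK_D(2)[OF u]]
  note E = classE_D[OF C(1)]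
  have pt: "(\<lambda>n. u n x) \<longlonglongrightarrow> g x" if "x \<in> {0..1}" for x
    using lim that by (rule tendsto_uniform_limitI)
  have dec: "decreasing01 g"
    unfolding decreasing01_def
  proof (intro ballI impI)
    fix x y :: real assume xy: "x \<in> {0..1}" "y \<in> {0..1}" "x \<le> y"
    show "g y \<le> g x"
      using E(1) xy by (intro LIMSEQ_le[OF pt[OF xy(2)] pt[OF xy(1)]]) (auto simp: decreasing01_def)
  qed
  have nonneg: "0 \<le> g x" if "x \<in> {0..1}" for x
    using E(5) that by (intro LIMSEQ_le_const[OF pt[OF that]]) auto
  have g0: "g 0 = 1"
    using pt[of 0] C(5) LIMSEQ_unique[OF _ tendsto_const] by fastforce
  have g1: "g 1 = 0"
    using pt[of 1] C(6) LIMSEQ_unique[OF _ tendsto_const] by fastforce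
  have cont: "continuous_on {0..1} g"
    using C(3) by (intro uniform_limit_theorem[OF _ lim]) auto
  have conv: "convex_on {0..1} g"
  proof (rule convex_onI)
    fix t x y :: real assume t: "0 < t" "t < 1" and xy: "x \<in> {0..1}" "y \<in> {0..1}"
    let ?z = "(1 - t) *\<^sub>R x + t *\<^sub>R y"
    have z: "?z \<in> {0..1}"
      using convexD_alt[of "{0..1}" x y t] xy t by simp
    have "(\<lambda>n. (1 - t) * u n x + t * u n y) \<longlonglongrightarrow> (1 - t) * g x + t * g y"
      by (intro tendsto_intros pt xy)
    then show "g ?z \<le> (1 - t) * g x + t * g y"
      using convex_onD[OF C(4) _ _ xy, of t] t
      by (intro LIMSEQ_le[OF pt[OF z]]) auto
  qed simp
  have stride: "1/5 - x \<le> 1/5 * g x" if x: "x \<in> {0..1}" for x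
  proof (rule LIMSEQ_le_const)
    show "(\<lambda>n. 1/5 * u n x) \<longlonglongrightarrow> 1/5 * g x"
      by (intro tendsto_intros pt x)
    show "\<exists>N. \<forall>n\<ge>N. 1/5 - x \<le> 1/5 * u n x"
      using u x by (auto simp: classK_iff)
  qed
  obtain I J where IJ: "\<And>n. (u n has_integral I n) {0..1}" "(g has_integral J) {0..1}"
      "(I \<longlongrightarrow> J) sequentially"
    using uniform_limit_integral[OF lim C(3)] by (metis sequentially_bot)
  have "I n = intg (u n)" for n
    using IJ(1)[of n] by (simp add: intg_def integral_unique)
  then have "1/5 \<le> J"
    using classK_D(4)[OF u] by (intro LIMSEQ_le_const[OF IJ(3)]) simp
  then have int: "1/5 \<le> intg g"
    using IJ(2) by (simp add: intg_def integral_unique)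
  show ?thesis
    unfolding classK_iff classC_convex_def classC_def classE_def
    using dec nonneg g0 g1 cont conv stride int by auto
qed

lemma seq_compact_classK_d_inf: "seq_compact_wrt classK d_inf"
  unfolding seq_compact_wrt_def
proof (intro allI impI)
  fix u :: "nat \<Rightarrow> real \<Rightarrow> real" assume "\<forall>n. u n \<in> classK"
  then have u: "u n \<in> classK" for n by blast
  note E = classE_D[OF classK_D(1)[OF u]]
  obtain g k where g: "continuous_on {0..1} g" and k: "strict_mono (k :: nat \<Rightarrow> nat)"
    and lim: "\<And>e. 0 < e \<Longrightarrow> \<exists>N. \<forall>n x. n \<ge> N \<and> x \<in> {0..1} \<longrightarrow> norm (u (k n) x - g x) < e"
  proof (rule Arzela_Ascoli[of "{0..1::real}" u 1])
    show "norm (u n x) \<le> 1" if "x \<in> {0..1}" for n x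
      using E(5,6)[OF that, of n] by simp
    show "\<exists>d>0. \<forall>n y. y \<in> {0..1} \<and> norm (x - y) < d \<longrightarrow> norm (u n x - u n y) < e"
      if x: "x \<in> {0..1}" and e: "0 < e" for x e
    proof (intro exI[of _ "e / 5"] conjI allI impI)
      fix n y assume y: "y \<in> {0..1} \<and> norm (x - y) < e / 5"
      then show "norm (u n x - u n y) < e"
        using classK_slope[OF u, of x y n] classK_slope[OF u, of y x n] x
        by (cases "x \<le> y") auto
    qed (use e in simp)
  qed auto
  have unif: "uniform_limit {0..1} (\<lambda>n. u (k n)) g sequentially"
    unfolding uniform_limit_sequentially_iff dist_norm using lim by metis
  have gK: "g \<in> classK"
    using u by (intro classK_uniform_limit[OF _ unif])
  have "(\<lambda>n. d_inf (u (k n)) g) \<longlonglongrightarrow> 0"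
  proof (rule LIMSEQ_I)
    fix e :: real assume e: "e > 0"
    \<comment> \<open>Passing to the supremum turns the strict bound into a weak one, hence
      \<open>e / 2\<close>.\<close>
    then obtain N where N: "\<And>n x. n \<ge> N \<Longrightarrow> x \<in> {0..1} \<Longrightarrow> norm (u (k n) x - g x) < e / 2"
      using lim[of "e / 2"] by auto
    have "norm (d_inf (u (k n)) g - 0) < e" if "n \<ge> N" for n
    proof -
      have "d_inf (u (k n)) g \<le> e / 2"
        using N[OF that] by (intro d_inf_le) force
      moreover have "0 \<le> d_inf (u (k n)) g"
        using d_1_nonneg[OF classK_D(3)[OF u] g] d_1_le_d_inf[OF classK_D(3)[OF u] g] order_trans by blast
      ultimately show ?thesis using e by simp
    qed
    then show "\<exists>N. \<forall>n\<ge>N. norm (d_inf (u (k n)) g - 0) < e" by blast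
  qed
  then show "\<exists>(r::nat\<Rightarrow>nat) g. strict_mono r \<and> g \<in> classK \<and> (\<lambda>n. d_inf (u (r n)) g) \<longlonglongrightarrow> 0"
    using k gK by blast
qed

text \<open>The subsequence and limit found for \<open>d_inf\<close> serve again, since
  \<open>d_1\<close> is squeezed between 0 and \<open>d_inf\<close>.\<close>

lemma seq_compact_classK_d_1: "seq_compact_wrt classK d_1"
  unfolding seq_compact_wrt_def
proof (intro allI impI)
  fix u :: "nat \<Rightarrow> real \<Rightarrow> real" assume u: "\<forall>n. u n \<in> classK"
  then obtain r :: "nat \<Rightarrow> nat" and g where r: "strict_mono r" and g: "g \<in> classK"
    and lim: "(\<lambda>n. d_inf (u (r n)) g) \<longlonglongrightarrow> 0"
    using seq_compact_classK_d_inf unfolding seq_compact_wrt_def by blast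
  have cont: "continuous_on {0..1} (u n)" "continuous_on {0..1} g" for n
    using u g classK_D(3) by auto
  have "(\<lambda>n. d_1 (u (r n)) g) \<longlonglongrightarrow> 0"
    by (rule tendsto_sandwich[OF _ _ tendsto_const lim])
      (simp_all add: d_1_nonneg d_1_le_d_inf cont)
  then show "\<exists>(r::nat\<Rightarrow>nat) g. strict_mono r \<and> g \<in> classK \<and> (\<lambda>n. d_1 (u (r n)) g) \<longlonglongrightarrow> 0"
    using r g by blast
qed

section \<open>Continuity of the operator on K\<close>

text \<open>The map \<open>max 0 (r - x)\<close> is 1-Lipschitz in \<open>r\<close>. At
  \<open>x = 0\<close> this also compares the integrals of \<open>f\<close> and
  \<open>g\<close>.\<close>

lemma excess_diff_le_d_1:
  assumes "f \<in> classC" "g \<in> classC"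
  shows "\<bar>excess f x - excess g x\<bar> \<le> d_1 f g"
proof -
  have cont: "continuous_on {0..1} f" "continuous_on {0..1} g"
    using assms by (auto simp: classC_def)
  have "decreasing01 f" "decreasing01 g"
    using assms by (auto simp: classC_def classE_def)
  note int = this[THEN excess_integrable]
  have "excess f x - excess g x = integral {0..1} (\<lambda>t. max 0 (f t - x) - max 0 (g t - x))"
    unfolding excess_def by (intro integral_diff[symmetric] int)
  also have "norm \<dots> \<le> d_1 f g"
    unfolding d_1_def
    by (intro integral_norm_bound_integral integrable_diff int abs_diff_integrable cont) auto
  finally show ?thesis by simp
qed

text \<open>Numerator and denominator of \<open>opT\<close> each change by at most
  \<open>d_1 f g\<close>; with \<open>opT g \<le> 1\<close> and \<open>intg f \<ge> 1/5\<close> the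
  constant is 2 / (1/5) = 10.\<close>

lemma opT_lipschitz:
  assumes f: "f \<in> classK" and g: "g \<in> classK"
  shows "d_inf (opT f) (opT g) \<le> 10 * d_1 f g"
proof (rule d_inf_le)
  fix x :: real assume x: "x \<in> {0..1}"
  note Ef = classK_D(1)[OF f] and Eg = classK_D(1)[OF g]
  let ?I = "intg f" and ?J = "intg g"
  have I: "?I \<ge> 1/5" "?J \<ge> 1/5"
    using f g by (auto dest: classK_D(4))
  have C: "f \<in> classC" "g \<in> classC"
    using f g by (auto simp: classK_def classC_convex_def)
  have a: "\<bar>excess f x - excess g x\<bar> \<le> d_1 f g" and b: "\<bar>?J - ?I\<bar> \<le> d_1 f g"
    using excess_diff_le_d_1[OF C, of x] excess_diff_le_d_1[OF C, of 0] excess_0 Ef Eg by auto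
  have "opT g \<in> classE"
    using opT_classK[OF g] by (rule classK_D(1))
  then have c: "0 \<le> opT g x" "opT g x \<le> 1"
    using classE_D(5,6) x by auto
  \<comment> \<open>Writing the difference over \<open>?I\<close> alone leaves
    \<open>opT g x\<close>, which lies in \<open>{0..1}\<close>, as the factor of
    \<open>?J - ?I\<close>.\<close>
  have "opT f x - opT g x = ((excess f x - excess g x) + opT g x * (?J - ?I)) / ?I"
    using I by (simp add: opT_eq[OF Ef x] opT_eq[OF Eg x] field_simps)
  also have "\<bar>\<dots>\<bar> = \<bar>(excess f x - excess g x) + opT g x * (?J - ?I)\<bar> / ?I"
    using I by (simp add: abs_divide)
  also have "\<dots> \<le> (2 * d_1 f g) / (1/5)"
  proof (rule frac_le)
    have "\<bar>opT g x * (?J - ?I)\<bar> \<le> 1 * d_1 f g"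
      unfolding abs_mult using b c by (intro mult_mono) simp_all
    then show "\<bar>(excess f x - excess g x) + opT g x * (?J - ?I)\<bar> \<le> 2 * d_1 f g"
      using a by linarith
  qed (use I a in auto)
  finally show "\<bar>opT f x - opT g x\<bar> \<le> 10 * d_1 f g"
    by simp
qed

text \<open>The Lipschitz bound from \<open>d_1\<close> to \<open>d_inf\<close> is the strongest of
  the four combinations, so comparing the metrics settles all of them.\<close>

lemma continuous_wrt_opT:
  assumes dom: "\<And>f g. f \<in> classK \<Longrightarrow> g \<in> classK \<Longrightarrow> d_1 f g \<le> da f g"
    and cod: "\<And>f g. f \<in> classK \<Longrightarrow> g \<in> classK \<Longrightarrow> db f g \<le> d_inf f g"
  shows "continuous_wrt classK da db opT"
  unfolding continuous_wrt_def
proof (intro ballI allI impI)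
  fix f and e :: real assume f: "f \<in> classK" and e: "e > 0"
  show "\<exists>\<delta>>0. \<forall>g\<in>classK. da f g < \<delta> \<longrightarrow> db (opT f) (opT g) < e"
  proof (intro exI[of _ "e / 10"] conjI ballI impI)
    fix g assume g: "g \<in> classK" and less: "da f g < e / 10"
    have "db (opT f) (opT g) \<le> d_inf (opT f) (opT g)"
      using f g by (intro cod opT_classK)
    also have "\<dots> \<le> 10 * d_1 f g"
      using f g by (rule opT_lipschitz)
    also have "\<dots> < e"
      using dom[OF f g] less by simp
    finally show "db (opT f) (opT g) < e" .
  qed (use e in simp)
qed

theorem theorem2p5:
  shows "opT ` classK \<subseteq> classK \<inter> classD_sharp_convex
    \<and> (\<forall>f\<in>classE. \<exists>n::nat. n \<ge> 1 \<and> (opT ^^ n) f \<in> classK)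
    \<and> (\<forall>f\<in>classK. \<forall>g\<in>classK. d_1 f g \<le> d_inf f g \<and> d_inf f g \<le> 5 * sqrt (d_1 f g))
    \<and> (complete_wrt classK d_inf \<and> complete_wrt classK d_1)
    \<and> (\<forall>da\<in>{d_inf, d_1}. \<forall>db\<in>{d_inf, d_1}. continuous_wrt classK da db opT)
    \<and> (seq_compact_wrt classK d_inf \<and> seq_compact_wrt classK d_1)"
proof (intro conjI)
  have le: "d_1 f g \<le> d_inf f g" if "f \<in> classK" "g \<in> classK" for f g
    using that by (intro d_1_le_d_inf classK_D(3))
  have nonneg: "0 \<le> d_1 f g" if "f \<in> classK" "g \<in> classK" for f g
    using that by (intro d_1_nonneg classK_D(3))
  show "opT ` classK \<subseteq> classK \<inter> classD_sharp_convex"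
    using opT_classK opT_sharp classK_D(2) by blast
  show "\<forall>f\<in>classE. \<exists>n::nat. n \<ge> 1 \<and> (opT ^^ n) f \<in> classK"
    using opT_absorbed by blast
  show "\<forall>f\<in>classK. \<forall>g\<in>classK. d_1 f g \<le> d_inf f g \<and> d_inf f g \<le> 5 * sqrt (d_1 f g)"
    using le d_inf_le_sqrt_d_1 by blast
  show "seq_compact_wrt classK d_inf" "seq_compact_wrt classK d_1"
    by (fact seq_compact_classK_d_inf seq_compact_classK_d_1)+
  show "complete_wrt classK d_inf"
    using order_trans[OF nonneg le]
    by (intro complete_wrt_if_seq_compact[OF seq_compact_classK_d_inf] d_inf_triangle classK_D(3))
  show "complete_wrt classK d_1"
    by (intro complete_wrt_if_seq_compact[OF seq_compact_classK_d_1] d_1_triangle classK_D(3) nonneg)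
  show "\<forall>da\<in>{d_inf, d_1}. \<forall>db\<in>{d_inf, d_1}. continuous_wrt classK da db opT"
    using continuous_wrt_opT le by auto
qed

end
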